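(* Let $D$ be a Prüfer domain such that, for every finitely generated ideal $I$ of $D$, the set $\operatorname{Min}(I)$ is compact. Then $D^\ast$ has (Krull) dimension at most $1$, and in particular $D^\ast$ is completely integrally closed.
   Context: A Prüfer domain is an integral domain $D$ such that $D_P$ is a valuation domain for every $P\in\operatorname{Spec}(D)$. For an integral domain $D$ with quotient field $K$, an element $z\in K$ is almost integral over $D$ if there is a nonzero $c\in D$ such that $cz^n\in D$ for every positive integer $n$; the complete integral closure $D^\ast$ of $D$ is the ring of all elements of $K$ that are almost integral over $D$, and $D$ is completely integrally closed if $D=D^\ast$. $\operatorname{Min}(I)$ denotes the set of minimal primes of $I$, i.e. the minimal elements (under inclusion) of the set $\mathcal{V}(I)$ of prime ideals of $D$ containing $I$; it is endowed with the subspace topology of the Zariski topology of $\operatorname{Spec}(D)$. Compact means that every open cover has a finite subcover (no Hausdorff condition). *)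

theory Defs
  imports "HOL-Algebra.Subrings" "HOL-Analysis.Abstract_Topology" "HOL-Library.Extended_Nat"
begin

text \<open>
  An integral domain \<open>D\<close> with quotient field \<open>K\<close> is represented as a subring (a set of
  elements) of a field \<open>K\<close> all of whose elements are fractions of elements of \<open>D\<close>. Rings
  between \<open>D\<close> and \<open>K\<close>, such as the localizations of \<open>D\<close> and its complete integral closure,
  are then also sets of elements of \<open>K\<close>; as rings in their own right they are
  \<open>K\<lparr>carrier := D\<rparr>\<close>.
\<close>

definition quotient_field :: "('a, 'b) ring_scheme \<Rightarrow> 'a set \<Rightarrow> bool" where
  "quotient_field K D \<longleftrightarrow> field K \<and> subdomain D K \<and>
     carrier K = {a \<otimes>\<^bsub>K\<^esub> inv\<^bsub>K\<^esub> b | a b. a \<in> D \<and> b \<in> D - {\<zero>\<^bsub>K\<^esub>}}"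

definition valuation_domain :: "('a, 'b) ring_scheme \<Rightarrow> 'a set \<Rightarrow> bool" where
  "valuation_domain K V \<longleftrightarrow> quotient_field K V \<and>
     (\<forall>z \<in> carrier K - {\<zero>\<^bsub>K\<^esub>}. z \<in> V \<or> inv\<^bsub>K\<^esub> z \<in> V)"

definition localization :: "('a, 'b) ring_scheme \<Rightarrow> 'a set \<Rightarrow> 'a set \<Rightarrow> 'a set" where
  "localization K D P = {a \<otimes>\<^bsub>K\<^esub> inv\<^bsub>K\<^esub> s | a s. a \<in> D \<and> s \<in> D - P}"

definition Spec :: "('a, 'b) ring_scheme \<Rightarrow> 'a set set" where
  "Spec R = {P. primeideal P R}"

definition prufer_domain :: "('a, 'b) ring_scheme \<Rightarrow> 'a set \<Rightarrow> bool" where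
  "prufer_domain K D \<longleftrightarrow> quotient_field K D \<and>
     (\<forall>P \<in> Spec (K\<lparr>carrier := D\<rparr>). valuation_domain K (localization K D P))"

definition almost_integral :: "('a, 'b) ring_scheme \<Rightarrow> 'a set \<Rightarrow> 'a \<Rightarrow> bool" where
  "almost_integral K D z \<longleftrightarrow>
     (\<exists>c \<in> D - {\<zero>\<^bsub>K\<^esub>}. \<forall>n::nat. n \<ge> 1 \<longrightarrow> c \<otimes>\<^bsub>K\<^esub> (z [^]\<^bsub>K\<^esub> n) \<in> D)"

definition complete_integral_closure :: "('a, 'b) ring_scheme \<Rightarrow> 'a set \<Rightarrow> 'a set" where
  "complete_integral_closure K D = {z \<in> carrier K. almost_integral K D z}"

definition completely_integrally_closed :: "('a, 'b) ring_scheme \<Rightarrow> 'a set \<Rightarrow> bool" where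
  "completely_integrally_closed K D \<longleftrightarrow>
     quotient_field K D \<and> complete_integral_closure K D = D"

definition primes_over :: "('a, 'b) ring_scheme \<Rightarrow> 'a set \<Rightarrow> 'a set set" where
  "primes_over R I = {P \<in> Spec R. I \<subseteq> P}"

definition minimal_primes :: "('a, 'b) ring_scheme \<Rightarrow> 'a set \<Rightarrow> 'a set set" where
  "minimal_primes R I = {P \<in> primes_over R I. \<forall>Q \<in> primes_over R I. Q \<subseteq> P \<longrightarrow> Q = P}"

definition finitely_generated_ideal :: "('a, 'b) ring_scheme \<Rightarrow> 'a set \<Rightarrow> bool" where
  "finitely_generated_ideal R I \<longleftrightarrow> (\<exists>S. finite S \<and> S \<subseteq> carrier R \<and> I = genideal R S)"

definition zariski_topology :: "('a, 'b) ring_scheme \<Rightarrow> 'a set topology" where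
  "zariski_topology R =
     topology (\<lambda>U. \<exists>I. ideal I R \<and> U = Spec R - primes_over R I)"

lemma istopology_zariski:
  assumes "cring R"
  shows "istopology (\<lambda>U. \<exists>I. ideal I R \<and> U = Spec R - primes_over R I)"
  unfolding istopology_def
proof (intro conjI allI impI)
  interpret cring R by fact
  fix U V
  assume "\<exists>I. ideal I R \<and> U = Spec R - primes_over R I"
    and "\<exists>I. ideal I R \<and> V = Spec R - primes_over R I"
  then obtain I J where I: "ideal I R" "U = Spec R - primes_over R I"
    and J: "ideal J R" "V = Spec R - primes_over R J"
    by blast
  have "I \<subseteq> P \<or> J \<subseteq> P" if P: "primeideal P R" and sub: "I \<inter> J \<subseteq> P" for P
  proof (rule ccontr)
    assume "\<not> (I \<subseteq> P \<or> J \<subseteq> P)"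
    then obtain a b where ab: "a \<in> I" "a \<notin> P" "b \<in> J" "b \<notin> P"
      by blast
    have c: "a \<in> carrier R" "b \<in> carrier R"
      using ab I(1) J(1) ideal.Icarr by metis+
    have "a \<otimes>\<^bsub>R\<^esub> b \<in> I \<inter> J"
      using ab c I(1) J(1) by (simp add: ideal.I_l_closed ideal.I_r_closed)
    then show False
      using sub primeideal.I_prime[OF P c] ab by blast
  qed
  then have "U \<inter> V = Spec R - primes_over R (I \<inter> J)"
    unfolding I(2) J(2) by (auto simp: Spec_def primes_over_def)
  then show "\<exists>I. ideal I R \<and> U \<inter> V = Spec R - primes_over R I"
    using i_intersect[OF I(1) J(1)] by blast
next
  interpret cring R by fact
  fix \<U>
  assume "\<forall>U\<in>\<U>. \<exists>I. ideal I R \<and> U = Spec R - primes_over R I"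
  then obtain f where f: "\<And>U. U \<in> \<U> \<Longrightarrow> ideal (f U) R"
      "\<And>U. U \<in> \<U> \<Longrightarrow> U = Spec R - primes_over R (f U)"
    by metis
  have sub: "(\<Union>U\<in>\<U>. f U) \<subseteq> carrier R"
    using f(1) ideal.Icarr by fastforce
  have "(genideal R (\<Union>U\<in>\<U>. f U) \<subseteq> P) \<longleftrightarrow> (\<forall>U\<in>\<U>. f U \<subseteq> P)" if "primeideal P R" for P
    using genideal_self[OF sub] genideal_minimal[of P] primeideal.axioms(1)[OF that]
    by (metis UN_subset_iff order_trans)
  then have "Spec R - primes_over R (genideal R (\<Union>U\<in>\<U>. f U))
      = (\<Union>U\<in>\<U>. Spec R - primes_over R (f U))"
    by (auto simp: Spec_def primes_over_def)
  also have "\<dots> = \<Union>\<U>"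
    using f(2) by auto
  finally show "\<exists>I. ideal I R \<and> \<Union>\<U> = Spec R - primes_over R I"
    using genideal_ideal[OF sub] by metis
qed

lemma openin_zariski_topology:
  assumes "cring R"
  shows "openin (zariski_topology R) U \<longleftrightarrow>
    (\<exists>I. ideal I R \<and> U = Spec R - primes_over R I)"
  by (simp add: zariski_topology_def topology_inverse'[OF istopology_zariski[OF assms]])

text \<open>Supremum of the lengths \<open>n\<close> of strict chains \<open>P 0 \<subset> P 1 \<subset> \<dots> \<subset> P n\<close> of prime ideals.\<close>

definition krull_dim :: "('a, 'b) ring_scheme \<Rightarrow> enat" where
  "krull_dim R = Sup {enat n | n. \<exists>P. (\<forall>i \<le> n. P i \<in> Spec R) \<and> (\<forall>i < n. P i \<subset> P (Suc i))}"

end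

theory Submission
  imports Defs
begin

text \<open>
  Let \<open>P\<^sub>0 \<subset> P\<^sub>1 \<subset> P\<^sub>2\<close> be primes of \<open>D\<^sup>*\<close>. Since the localizations of \<open>D\<close> are valuation domains,
  contraction to \<open>D\<close> preserves strict inclusions, so that there is a \<open>c \<noteq> 0\<close> in \<open>P\<^sub>1 \<inter> D\<close> and
  \<open>P\<^sub>2 \<inter> D\<close> lies in no minimal prime of \<open>c\<close>. By compactness of \<open>Min(c)\<close>, already a finite
  \<open>X \<subseteq> P\<^sub>2 \<inter> D\<close> with \<open>c \<in> X\<close> lies in no minimal prime of \<open>c\<close>, and hence locally \<open>c\<close> is divisible
  by all powers of the ideal generated by \<open>X\<close>. So every \<open>z \<in> K\<close> with \<open>z X \<subseteq> D\<close> satisfies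
  \<open>c z\<^sup>n \<in> D\<close> for all \<open>n\<close>, that is, \<open>z \<in> D\<^sup>*\<close>. If \<open>y \<in> X\<close> generates this ideal locally at
  \<open>P\<^sub>2 \<inter> D\<close>, then \<open>z = s / y\<close> is such an element for some \<open>s \<in> D - P\<^sub>2\<close>, and \<open>s = z y \<in> P\<^sub>2\<close> is a
  contradiction. Finally, an overring of \<open>D\<close> of dimension at most \<open>1\<close> is an intersection of
  valuation domains of rank at most \<open>1\<close>, which are completely integrally closed.
\<close>

section \<open>Ideals, minimal primes and compactness in a commutative ring\<close>

lemma (in cring) ideal_iff:
  "ideal I R \<longleftrightarrow> I \<subseteq> carrier R \<and> \<zero> \<in> I \<and> (\<forall>x\<in>I. \<forall>y\<in>I. x \<oplus> y \<in> I) \<and>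
     (\<forall>a\<in>carrier R. \<forall>x\<in>I. a \<otimes> x \<in> I)" (is "_ \<longleftrightarrow> ?rhs")
proof
  assume "ideal I R"
  then interpret ideal I R .
  show ?rhs
    using a_subset zero_closed I_l_closed by auto
next
  assume r: ?rhs
  have "\<ominus> x \<in> I" if "x \<in> I" for x
  proof -
    have "\<ominus> x = (\<ominus> \<one>) \<otimes> x"
      using that r by (metis l_minus l_one one_closed subsetD)
    then show ?thesis using r that by simp
  qed
  then have "subgroup I (add_monoid R)"
    using r by (intro add.subgroupI) (auto simp: a_inv_def)
  moreover have "a \<otimes> x \<in> I \<and> x \<otimes> a \<in> I" if "a \<in> carrier R" "x \<in> I" for a x
    using r that m_comm[of a x] by (metis subsetD)
  ultimately show "ideal I R"
    by (intro idealI ring_axioms) auto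
qed

lemma (in cring) primeideal_iff:
  "primeideal P R \<longleftrightarrow> ideal P R \<and> \<one> \<notin> P \<and>
     (\<forall>a\<in>carrier R. \<forall>b\<in>carrier R. a \<otimes> b \<in> P \<longrightarrow> a \<in> P \<or> b \<in> P)"
  by (metis cring_axioms ideal.one_imp_carrier one_closed primeideal.I_notcarr
      primeideal.I_prime primeideal.axioms(1) primeidealI)

lemma (in cring) exists_maximalideal:
  assumes I: "ideal I R" and ne: "\<one> \<notin> I"
  obtains M where "maximalideal M R" "I \<subseteq> M"
proof -
  let ?A = "{J. ideal J R \<and> I \<subseteq> J \<and> \<one> \<notin> J}"
  have "\<exists>M\<in>?A. \<forall>J\<in>?A. M \<subseteq> J \<longrightarrow> J = M"
  proof (rule subset_Zorn_nonempty)
    show "?A \<noteq> {}" using I ne by blast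
  next
    fix C assume C: "C \<noteq> {}" "subset.chain ?A C"
    have id: "ideal J R" if "J \<in> C" for J
      using C(2) that by (auto simp: subset_chain_def)
    have "x \<oplus> y \<in> \<Union>C" if "x \<in> J" "J \<in> C" "y \<in> J'" "J' \<in> C" for x y J J'
    proof -
      have "J \<subseteq> J' \<or> J' \<subseteq> J" using C(2) that by (auto simp: subset_chain_def)
      then show ?thesis using id that unfolding ideal_iff by blast
    qed
    then have "\<forall>x\<in>\<Union>C. \<forall>y\<in>\<Union>C. x \<oplus> y \<in> \<Union>C" by blast
    moreover have "a \<otimes> x \<in> \<Union>C" if "a \<in> carrier R" "x \<in> \<Union>C" for a x
      using that id by (meson UnionE UnionI ideal.I_l_closed)
    moreover have "\<Union>C \<subseteq> carrier R" using id by (meson Sup_least ideal.Icarr subsetI)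
    moreover have "\<zero> \<in> \<Union>C"
      using id C(1) by (meson UnionI additive_subgroup.zero_closed equals0I ideal.axioms(1))
    ultimately have "ideal (\<Union>C) R" unfolding ideal_iff by blast
    then show "\<Union>C \<in> ?A"
      using C by (auto simp: subset_chain_def)
  qed
  then obtain M where M: "ideal M R" "I \<subseteq> M" "\<one> \<notin> M"
    and max: "\<And>J. ideal J R \<Longrightarrow> I \<subseteq> J \<Longrightarrow> \<one> \<notin> J \<Longrightarrow> M \<subseteq> J \<Longrightarrow> J = M"
    by auto
  have "maximalideal M R"
  proof (rule maximalidealI)
    show "J = M \<or> J = carrier R" if "ideal J R" "M \<subseteq> J" for J
      using that max[of J] M(2) ideal.one_imp_carrier[of J R] by blast
  qed (use M in auto)
  then show ?thesis using M(2) by (rule that)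
qed

text \<open>The intersection of a nonempty chain of primes is prime, so Zorn's lemma applies to the
  primes between \<open>I\<close> and \<open>M\<close>.\<close>

lemma (in cring) minimal_prime_below:
  assumes "M \<in> primes_over R I"
  obtains P where "P \<in> minimal_primes R I" "P \<subseteq> M"
proof -
  let ?A = "{P \<in> primes_over R I. P \<subseteq> M}"
  \<comment> \<open>Zorn's lemma yields maximal elements; passing to complements turns these into
    minimal primes.\<close>
  have "\<exists>P\<in>uminus ` ?A. \<forall>Q\<in>uminus ` ?A. P \<subseteq> Q \<longrightarrow> Q = P"
  proof (rule subset_Zorn_nonempty)
    show "uminus ` ?A \<noteq> {}" using assms by blast
  next
    fix C assume C: "C \<noteq> {}" "subset.chain (uminus ` ?A) C"
    define B where "B = uminus ` C"
    have B: "B \<noteq> {}" "\<Union>C = - \<Inter>B" using C(1) by (auto simp: B_def)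
    have sub: "B \<subseteq> ?A" using C(2) by (auto simp: B_def subset_chain_def)
    have lin: "P \<subseteq> Q \<or> Q \<subseteq> P" if "P \<in> B" "Q \<in> B" for P Q
    proof -
      have "- P \<in> C" "- Q \<in> C" using that by (auto simp: B_def)
      then have "- P \<subseteq> - Q \<or> - Q \<subseteq> - P" using C(2) by (simp only: subset_chain_def)
      then show ?thesis by blast
    qed
    have pr: "primeideal P R" if "P \<in> B" for P
      using sub that by (auto simp: primes_over_def Spec_def)
    have "a \<in> \<Inter>B \<or> b \<in> \<Inter>B"
      if ab: "a \<in> carrier R" "b \<in> carrier R" "a \<otimes> b \<in> \<Inter>B" for a b
    proof (rule ccontr)
      assume "\<not> ?thesis"
      then obtain P Q where PQ: "P \<in> B" "a \<notin> P" "Q \<in> B" "b \<notin> Q" by blast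
      \<comment> \<open>\<open>N\<close> is the smaller of the two primes \<open>P\<close> and
        \<open>Q\<close>.\<close>
      then obtain N where "N \<in> B" "a \<notin> N" "b \<notin> N" using lin by blast
      then show False using pr[of N] ab unfolding primeideal_iff by blast
    qed
    moreover have "ideal (\<Inter>B) R"
      using B(1) pr by (intro i_Intersect) (auto simp: primeideal_iff)
    moreover have "\<one> \<notin> \<Inter>B"
      using B(1) pr by (auto simp: primeideal_iff)
    ultimately have "primeideal (\<Inter>B) R" unfolding primeideal_iff by blast
    then have "\<Inter>B \<in> ?A"
      using B(1) sub by (auto simp: primes_over_def Spec_def)
    then show "\<Union>C \<in> uminus ` ?A" using B(2) by blast
  qed
  then obtain P where P: "P \<in> ?A" and min: "\<And>Q. Q \<in> ?A \<Longrightarrow> Q \<subseteq> P \<Longrightarrow> Q = P"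
    by auto
  have "P \<in> minimal_primes R I"
    using P min unfolding minimal_primes_def by blast
  with P that show ?thesis by blast
qed

lemma (in cring) primes_over_genideal:
  assumes "c \<in> carrier R"
  shows "P \<in> primes_over R (Idl {c}) \<longleftrightarrow> P \<in> Spec R \<and> c \<in> P"
  using genideal_minimal[of P "{c}"] genideal_self'[OF assms]
  by (auto simp: Spec_def primes_over_def dest: primeideal.axioms(1))

lemma minimal_primesD:
  "P \<in> minimal_primes R I \<Longrightarrow> Q \<in> primes_over R I \<Longrightarrow> Q \<subseteq> P \<Longrightarrow> Q = P"
  by (simp add: minimal_primes_def)

text \<open>For \<open>x\<close> in \<open>A\<close>, the primes that omit \<open>x\<close> form an
  open set, and \<open>avoid\<close> says that these sets cover the minimal primes of
  \<open>I\<close>. The indices of a finite subcover form \<open>X\<close>.\<close>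

lemma (in cring) compact_minimal_primes_avoidance:
  assumes comp: "compact_space (subtopology (zariski_topology R) (minimal_primes R I))"
    and sub: "A \<subseteq> carrier R"
    and avoid: "\<And>P. P \<in> minimal_primes R I \<Longrightarrow> \<not> A \<subseteq> P"
  obtains X where "finite X" "X \<subseteq> A" "\<And>P. P \<in> minimal_primes R I \<Longrightarrow> \<not> X \<subseteq> P"
proof -
  let ?T = "zariski_topology R"
  let ?U = "\<lambda>x. Spec R - primes_over R (Idl {x})"
  have U: "P \<in> ?U x \<longleftrightarrow> P \<in> Spec R \<and> x \<notin> P" if "x \<in> carrier R" for x P
    using that by (auto simp: primes_over_genideal)
  have op: "openin ?T (?U x)" if "x \<in> carrier R" for x
    unfolding openin_zariski_topology[OF cring_axioms]
    using that genideal_ideal[of "{x}"] by blast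
  have min: "minimal_primes R I \<subseteq> Spec R"
    by (auto simp: minimal_primes_def primes_over_def)
  have cover: "minimal_primes R I \<subseteq> \<Union>(?U ` A)"
  proof
    fix P assume P: "P \<in> minimal_primes R I"
    then obtain x where "x \<in> A" "x \<notin> P" using avoid by blast
    then show "P \<in> \<Union>(?U ` A)" using P min sub U[of x P] by blast
  qed
  \<comment> \<open>\<open>compactin\<close> also demands a subset of the space; a cover by open
    sets supplies this.\<close>
  then have "minimal_primes R I \<subseteq> topspace ?T"
    using op sub openin_subset by (meson UN_least order_trans subsetD)
  then have "compactin ?T (minimal_primes R I)"
    using comp by (simp add: compactin_subspace)
  moreover have "\<forall>V\<in>?U ` A. openin ?T V"
    using op sub by blast
  ultimately obtain F where F: "finite F" "F \<subseteq> ?U ` A" "minimal_primes R I \<subseteq> \<Union>F"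
    using cover unfolding compactin_def by meson
  then obtain X where X: "X \<subseteq> A" "finite X" "F = ?U ` X"
    using finite_subset_image[OF F(1,2)] by blast
  have "\<not> X \<subseteq> P" if P: "P \<in> minimal_primes R I" for P
  proof -
    obtain x where "x \<in> X" "P \<in> ?U x" using F(3) P X(3) by blast
    then show ?thesis using U[of x P] X(1) sub by blast
  qed
  then show ?thesis by (rule that[OF X(2,1)])
qed

section \<open>Subrings of a field and their complete integral closure\<close>

locale field_subring = field K for K (structure) +
  fixes D
  assumes subring: "subring D K"
begin

abbreviation "A \<equiv> K\<lparr>carrier := D\<rparr>"

lemma cring: "cring A"
  using subcring_iff subcringI'[OF subring] subringE(1)[OF subring] by blast

lemmas closed [simp] = subringE(2,3,5-7)[OF subring]

lemma sub_carrier [simp]: "x \<in> D \<Longrightarrow> x \<in> carrier K"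
  using subringE(1)[OF subring] by blast

lemma pow_closed [simp]: "x \<in> D \<Longrightarrow> x [^] (n::nat) \<in> D"
  by (induction n) auto

lemma ideal_iff_subring:
  "ideal I A \<longleftrightarrow> I \<subseteq> D \<and> \<zero> \<in> I \<and> (\<forall>x\<in>I. \<forall>y\<in>I. x \<oplus> y \<in> I) \<and>
     (\<forall>a\<in>D. \<forall>x\<in>I. a \<otimes> x \<in> I)"
  using cring.ideal_iff[OF cring] by simp

lemma Spec_iff:
  "P \<in> Spec A \<longleftrightarrow> ideal P A \<and> \<one> \<notin> P \<and> (\<forall>a\<in>D. \<forall>b\<in>D. a \<otimes> b \<in> P \<longrightarrow> a \<in> P \<or> b \<in> P)"
  using cring.primeideal_iff[OF cring] by (simp add: Spec_def)

lemma
  assumes "P \<in> Spec A"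
  shows Spec_subset: "P \<subseteq> D" 
    and Spec_zero: "\<zero> \<in> P" 
    and Spec_one: "\<one> \<notin> P"
    and Spec_add: "x \<in> P \<Longrightarrow> y \<in> P \<Longrightarrow> x \<oplus> y \<in> P"
    and Spec_mult: "a \<in> D \<Longrightarrow> x \<in> P \<Longrightarrow> a \<otimes> x \<in> P"
    and Spec_prime: "a \<in> D \<Longrightarrow> b \<in> D \<Longrightarrow> a \<otimes> b \<in> P \<longleftrightarrow> a \<in> P \<or> b \<in> P"
proof -
  show "\<And>a x. a \<in> D \<Longrightarrow> x \<in> P \<Longrightarrow> a \<otimes> x \<in> P"
    using assms unfolding Spec_iff ideal_iff_subring by blast
  then show "a \<in> D \<Longrightarrow> b \<in> D \<Longrightarrow> a \<otimes> b \<in> P \<longleftrightarrow> a \<in> P \<or> b \<in> P"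
    using assms m_comm[of a b] unfolding Spec_iff by (metis sub_carrier)
qed (use assms in \<open>auto simp: Spec_iff ideal_iff_subring\<close>)

lemma Spec_pow: "P \<in> Spec A \<Longrightarrow> a \<in> D \<Longrightarrow> a [^] (n::nat) \<in> P \<Longrightarrow> a \<in> P"
  by (induction n) (auto simp: Spec_one Spec_prime)

lemmas primes_over_genideal_subring = cring.primes_over_genideal[OF cring, simplified]

text \<open>The denominators of \<open>u\<close> form an ideal of \<open>D\<close>. No maximal ideal
  contains it, since every localization contains \<open>u\<close>, and so \<open>\<one>\<close> is a
  denominator.\<close>

lemma mem_if_locally_mem:
  assumes u: "u \<in> carrier K" and loc: "\<And>P. P \<in> Spec A \<Longrightarrow> \<exists>s\<in>D - P. s \<otimes> u \<in> D"
  shows "u \<in> D"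
proof (rule ccontr)
  assume nu: "u \<notin> D"
  let ?I = "{d \<in> D. d \<otimes> u \<in> D}"
  have "ideal ?I A"
    unfolding ideal_iff_subring using u by (auto simp: l_distr m_assoc)
  moreover have "\<one> \<notin> ?I" using nu u by simp
  ultimately obtain M where M: "maximalideal M A" "?I \<subseteq> M"
    using cring.exists_maximalideal[OF cring, of ?I] by auto
  then have "M \<in> Spec A"
    using cring.maximalideal_prime[OF cring] by (simp add: Spec_def)
  then obtain s where "s \<in> D" "s \<notin> M" "s \<otimes> u \<in> D"
    using loc by (meson DiffE)
  with M(2) show False by (simp add: subset_iff)
qed

lemma contraction_Spec:
  assumes E: "field_subring K E" "D \<subseteq> E" and Q: "Q \<in> Spec (K\<lparr>carrier := E\<rparr>)"
  shows "Q \<inter> D \<in> Spec A"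
proof -
  interpret E: field_subring K E by fact
  have "ideal (Q \<inter> D) A"
    unfolding ideal_iff_subring using E.Spec_add[OF Q] E.Spec_mult[OF Q] E.Spec_zero[OF Q] E(2)
    by (auto simp: subset_iff)
  moreover have "a \<in> Q \<or> b \<in> Q" if "a \<in> D" "b \<in> D" "a \<otimes> b \<in> Q" for a b
    using that E.Spec_prime[OF Q, of a b] E(2) by blast
  ultimately show ?thesis
    unfolding Spec_iff using E.Spec_one[OF Q] by blast
qed

lemma subset_complete_integral_closure: "D \<subseteq> complete_integral_closure K D"
  using one_not_zero
  by (auto simp: complete_integral_closure_def almost_integral_def intro!: bexI[of _ \<one>])

text \<open>If \<open>c z^i \<in> D\<close> and \<open>d w^j \<in> D\<close> for all exponents, then the elements \<open>u\<close> with
  \<open>c d u z^i w^j \<in> D\<close> for all \<open>i\<close> and \<open>j\<close> form an additive group that is closed under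
  multiplication by \<open>z\<close> and \<open>w\<close>. It hence contains the powers of \<open>z + w\<close> and \<open>z w\<close>.\<close>
lemma complete_integral_closure_add_mult:
  assumes "z \<in> complete_integral_closure K D" "w \<in> complete_integral_closure K D"
  shows "z \<oplus> w \<in> complete_integral_closure K D" "z \<otimes> w \<in> complete_integral_closure K D"
proof -
  have zw: "z \<in> carrier K" "w \<in> carrier K"
    using assms by (auto simp: complete_integral_closure_def)
  obtain c where c: "c \<in> D" "c \<noteq> \<zero>" "\<And>n::nat. n \<ge> 1 \<Longrightarrow> c \<otimes> z [^] n \<in> D"
    using assms by (auto simp: complete_integral_closure_def almost_integral_def)
  obtain d where d: "d \<in> D" "d \<noteq> \<zero>" "\<And>n::nat. n \<ge> 1 \<Longrightarrow> d \<otimes> w [^] n \<in> D"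
    using assms by (auto simp: complete_integral_closure_def almost_integral_def)
  have c': "c \<otimes> z [^] n \<in> D" for n :: nat
    using c(1) c(3)[of n] by (cases "n = 0") auto
  have d': "d \<otimes> w [^] n \<in> D" for n :: nat
    using d(1) d(3)[of n] by (cases "n = 0") auto
  define N where "N = {u \<in> carrier K. \<forall>(i::nat) (j::nat). c \<otimes> d \<otimes> (u \<otimes> (z [^] i \<otimes> w [^] j)) \<in> D}"
  have N1: "\<one> \<in> N"
  proof -
    have "c \<otimes> d \<otimes> (\<one> \<otimes> (z [^] i \<otimes> w [^] j)) = (c \<otimes> z [^] i) \<otimes> (d \<otimes> w [^] j)"
      for i j :: nat
      using c(1) d(1) zw by (simp add: m_ac)
    then show ?thesis using closed(4)[OF c' d'] by (simp add: N_def)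
  qed
  have Nadd: "u \<oplus> v \<in> N" if "u \<in> N" "v \<in> N" for u v
    using that c(1) d(1) zw by (auto simp: N_def l_distr r_distr)
  have Nz: "z \<otimes> u \<in> N" if u: "u \<in> N" for u
  proof -
    have eq: "z \<otimes> u \<otimes> (z [^] i \<otimes> w [^] j) = u \<otimes> (z [^] Suc i \<otimes> w [^] j)" for i j :: nat
      using u zw by (simp add: m_ac N_def)
    have "c \<otimes> d \<otimes> (z \<otimes> u \<otimes> (z [^] i \<otimes> w [^] j)) \<in> D" for i j :: nat
      using u unfolding N_def eq by blast
    then show ?thesis using u zw by (simp add: N_def)
  qed
  have Nw: "w \<otimes> u \<in> N" if u: "u \<in> N" for u
  proof -
    have eq: "w \<otimes> u \<otimes> (z [^] i \<otimes> w [^] j) = u \<otimes> (z [^] i \<otimes> w [^] Suc j)" for i j :: nat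
      using u zw by (simp add: m_ac N_def)
    have "c \<otimes> d \<otimes> (w \<otimes> u \<otimes> (z [^] i \<otimes> w [^] j)) \<in> D" for i j :: nat
      using u unfolding N_def eq by blast
    then show ?thesis using u zw by (simp add: N_def)
  qed
  have closure: "x \<in> complete_integral_closure K D"
    if x: "x \<in> carrier K" "\<And>u. u \<in> N \<Longrightarrow> x \<otimes> u \<in> N" for x
  proof -
    have "x [^] n \<in> N" for n :: nat
    proof (induction n)
      case (Suc n)
      then show ?case using x(2)[of "x [^] n"] x(1) by (simp add: m_comm)
    qed (simp add: N1)
    then have "c \<otimes> d \<otimes> (x [^] n \<otimes> (z [^] (0::nat) \<otimes> w [^] (0::nat))) \<in> D" for n :: nat
      unfolding N_def by blast
    then have "c \<otimes> d \<otimes> x [^] n \<in> D" for n :: nat using x(1) by simp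
    moreover have "c \<otimes> d \<in> D - {\<zero>}" using c(1,2) d(1,2) integral[of c d] by auto
    ultimately show ?thesis
      using x(1) unfolding complete_integral_closure_def almost_integral_def by blast
  qed
  have sub: "u \<in> carrier K" if "u \<in> N" for u using that by (simp add: N_def)
  show "z \<oplus> w \<in> complete_integral_closure K D"
    using zw sub Nadd Nz Nw by (intro closure) (auto simp: l_distr)
  show "z \<otimes> w \<in> complete_integral_closure K D"
    using zw sub Nz Nw by (intro closure) (auto simp: m_assoc)
qed

lemma field_subring_complete_integral_closure: "field_subring K (complete_integral_closure K D)"
proof (intro field_subring.intro field_axioms field_subring_axioms.intro)
  have 1: "\<ominus> \<one> \<in> complete_integral_closure K D" "\<one> \<in> complete_integral_closure K D"
    using subset_complete_integral_closure by auto
  have sub: "complete_integral_closure K D \<subseteq> carrier K"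
    by (auto simp: complete_integral_closure_def)
  show "subring (complete_integral_closure K D) K"
  proof (rule subringI)
    fix h assume h: "h \<in> complete_integral_closure K D"
    then have "\<ominus> \<one> \<otimes> h \<in> complete_integral_closure K D"
      using 1 complete_integral_closure_add_mult by blast
    then show "\<ominus> h \<in> complete_integral_closure K D"
      using h sub by (auto simp: l_minus)
  qed (use 1 sub complete_integral_closure_add_mult in auto)
qed

end

section \<open>Subrings whose localizations at primes are valuation rings\<close>

text \<open>The assumption says that \<open>x / y\<close> or \<open>y / x\<close> lies in the localization at \<open>P\<close>, with
  denominators cleared.\<close>
locale locally_valuation_ring = field_subring +
  assumes comparable: "\<lbrakk>P \<in> Spec A; x \<in> carrier K; y \<in> carrier K\<rbrakk> \<Longrightarrow>
    \<exists>s\<in>D - P. \<exists>a\<in>D. s \<otimes> x = a \<otimes> y \<or> s \<otimes> y = a \<otimes> x"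
begin

lemma comparable_cases:
  assumes "P \<in> Spec A" "x \<in> carrier K" "y \<in> carrier K"
  obtains (left) s a where "s \<in> D" "s \<notin> P" "a \<in> D" "s \<otimes> x = a \<otimes> y"
    | (right) s a where "s \<in> D" "s \<notin> P" "a \<in> D" "s \<otimes> y = a \<otimes> x"
  using comparable[OF assms] by blast

text \<open>In a valuation ring, an element of least value divides all others. The induction carries
  such a \<open>y\<close> along with a common denominator \<open>s\<close> outside
  \<open>P\<close>.\<close>

lemma finite_locally_principal:
  assumes "finite X" "X \<noteq> {}" "X \<subseteq> carrier K" and P: "P \<in> Spec A"
  shows "\<exists>y\<in>X. \<exists>s\<in>D - P. \<forall>x\<in>X. \<exists>a\<in>D. s \<otimes> x = a \<otimes> y"
  using assms(1-3)
proof (induction X rule: finite_ne_induct)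
  case (singleton x)
  then show ?case using Spec_one[OF P] by (auto intro!: bexI[of _ \<one>])
next
  case (insert x X)
  then obtain y s where y: "y \<in> X" and s: "s \<in> D" "s \<notin> P"
    and ys: "\<And>w. w \<in> X \<Longrightarrow> \<exists>a\<in>D. s \<otimes> w = a \<otimes> y"
    by auto
  have c [simp]: "x \<in> carrier K" "y \<in> carrier K" "\<And>w. w \<in> X \<Longrightarrow> w \<in> carrier K" 
    using insert.prems y by auto
  from P c(1,2) show ?case
  proof (cases rule: comparable_cases)
    \<comment> \<open>Locally \<open>x\<close> is a multiple of \<open>y\<close>, so
      \<open>y\<close> remains the common divisor.\<close>
    case t: (left t a)
    have ts: "t \<otimes> s \<in> D - P" using t s P by (simp add: Spec_prime)
    have "t \<otimes> s \<otimes> x = (s \<otimes> a) \<otimes> y"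
      using t s by (metis c(1,2) m_assoc m_comm sub_carrier)
    moreover have "\<exists>b\<in>D. t \<otimes> s \<otimes> w = b \<otimes> y" if "w \<in> X" for w
      using ys[OF that] s t that by (metis c m_assoc sub_carrier closed(4))
    ultimately show ?thesis
      using ts y t s by (intro bexI[of _ y] bexI[of _ "t \<otimes> s"]) (auto intro: closed(4))
  next
    \<comment> \<open>Locally \<open>y\<close> is a multiple of \<open>x\<close>, so
      \<open>x\<close> takes over and divides the rest through \<open>y\<close>.\<close>
    case t: (right t a)
    have ts: "t \<otimes> s \<in> D - P" using t s P by (simp add: Spec_prime)
    have "\<exists>b\<in>D. t \<otimes> s \<otimes> w = b \<otimes> x" if w: "w \<in> X" for w
    proof -
      obtain b where b: "b \<in> D" "s \<otimes> w = b \<otimes> y" using ys[OF w] by blast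
      have "t \<otimes> s \<otimes> w = t \<otimes> (b \<otimes> y)" using b s t w by (simp add: m_assoc)
      also have "\<dots> = b \<otimes> (t \<otimes> y)" using b t by (simp add: m_lcomm)
      also have "\<dots> = (b \<otimes> a) \<otimes> x" using b t by (simp add: m_assoc)
      finally show ?thesis using b t by (auto intro: closed(4))
    qed
    then show ?thesis
      using ts t s by (intro bexI[of _ x] bexI[of _ "t \<otimes> s"]) auto
  qed
qed

text \<open>At a prime \<open>M\<close>, some \<open>x\<close> in \<open>X\<close> divides all of
  \<open>X\<close>, and \<open>x [^] n \<otimes> z [^] n\<close> lies in \<open>D\<close>. It thus
  suffices that locally \<open>x [^] n\<close> divides \<open>c\<close> or is a unit.\<close>

lemma mult_pow_mem:
  assumes X: "finite X" "X \<subseteq> D" "c \<in> X"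
    and avoid: "\<And>P. P \<in> minimal_primes A (genideal A {c}) \<Longrightarrow> \<not> X \<subseteq> P"
    and z: "z \<in> carrier K" "\<And>x. x \<in> X \<Longrightarrow> x \<otimes> z \<in> D"
  shows "c \<otimes> z [^] (n::nat) \<in> D"
proof (rule mem_if_locally_mem)
  have c: "c \<in> D" using X by blast
  then show "c \<otimes> z [^] n \<in> carrier K" using z by simp
  fix M assume M: "M \<in> Spec A"
  obtain x s where x: "x \<in> X" and s: "s \<in> D" "s \<notin> M"
    and dom: "\<And>w. w \<in> X \<Longrightarrow> \<exists>a\<in>D. s \<otimes> w = a \<otimes> x"
    using finite_locally_principal[OF X(1) _ _ M] X by (metis DiffE empty_iff subset_iff sub_carrier)
  have xD: "x \<in> D" using x X by blast
  have xz: "x [^] n \<otimes> z [^] n \<in> D"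
    using pow_closed[OF z(2)[OF x], of n] xD z by (simp add: nat_pow_distrib)
  have cx: "c \<in> carrier K" "x [^] n \<in> carrier K" using c xD by auto
  from M cx show "\<exists>s\<in>D - M. s \<otimes> (c \<otimes> z [^] n) \<in> D"
  proof (cases rule: comparable_cases)
    case t: (left t a)
    have "t \<otimes> (c \<otimes> z [^] n) = (t \<otimes> c) \<otimes> z [^] n" using t(1) c z by (simp add: m_assoc)
    also have "\<dots> = a \<otimes> (x [^] n \<otimes> z [^] n)" unfolding t(4) using t(3) xD z by (simp add: m_assoc)
    finally have "t \<otimes> (c \<otimes> z [^] n) \<in> D" using t(3) xz by simp
    then show ?thesis using t(1,2) by blast
  next
    case t: (right t a)
    show ?thesis
    proof (cases "c \<in> M")
      \<comment> \<open>This case is contradictory. Since \<open>x\<close> locally divides an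
        element \<open>w\<close> of \<open>X\<close> outside \<open>P\<close>, it is outside
        \<open>P\<close> itself, and so is \<open>t \<otimes> x [^] n\<close>; but this equals
        \<open>a \<otimes> c\<close>, which lies in \<open>P\<close>.\<close>
      case True
      have "M \<in> primes_over A (genideal A {c})"
        using True M c by (simp add: primes_over_genideal_subring)
      then obtain P where P: "P \<in> minimal_primes A (genideal A {c})" "P \<subseteq> M"
        using cring.minimal_prime_below[OF cring] by blast
      then have PS: "P \<in> Spec A" and cP: "c \<in> P"
        using c by (auto simp: minimal_primes_def primes_over_genideal_subring)
      obtain w where w: "w \<in> X" "w \<notin> P" using avoid[OF P(1)] by blast
      obtain b where b: "b \<in> D" "s \<otimes> w = b \<otimes> x" using dom[OF w(1)] by blast
      have "s \<otimes> w \<notin> P" using s w P(2) X(2) Spec_prime[OF PS, of s w] by blast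
      then have "x \<notin> P" using b(1) Spec_mult[OF PS b(1)] unfolding b(2) by blast
      then have "t \<otimes> x [^] n \<notin> P"
        using t(1,2) P(2) xD Spec_pow[OF PS xD] Spec_prime[OF PS, of t "x [^] n"] by auto
      then show ?thesis using Spec_mult[OF PS t(3) cP] t(4) by simp
    next
      \<comment> \<open>Here \<open>x\<close> divides \<open>s \<otimes> c\<close>, which is outside
        \<open>M\<close>, so \<open>x [^] n\<close> can serve as the denominator.\<close>
      case False
      obtain b where b: "b \<in> D" "s \<otimes> c = b \<otimes> x" using dom[OF X(3)] by blast
      have "s \<otimes> c \<notin> M" using s False c M by (simp add: Spec_prime)
      then have "x \<notin> M" using b xD M by (auto simp: Spec_prime)
      then have "x [^] n \<in> D - M" using Spec_pow[OF M] xD by auto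
      moreover have "x [^] n \<otimes> (c \<otimes> z [^] n) = c \<otimes> (x [^] n \<otimes> z [^] n)"
        using c xD z by (simp add: m_lcomm)
      ultimately show ?thesis using xz c by (intro bexI[of _ "x [^] n"]) auto
    qed
  qed
qed

text \<open>Some \<open>z\<close> in \<open>Q' - Q\<close> is compared with \<open>\<one>\<close> at
  \<open>Q' \<inter> D\<close>. Either a multiple \<open>s \<otimes> z\<close> with \<open>s\<close>
  outside \<open>Q'\<close> lies in \<open>D\<close> and is the required element, or some
  \<open>s\<close> outside \<open>Q'\<close> is a multiple of \<open>z\<close>, which is
  absurd.\<close>

lemma prime_contraction_strict:
  assumes E: "field_subring K E" "D \<subseteq> E"
    and Q: "Q \<in> Spec (K\<lparr>carrier := E\<rparr>)" "Q' \<in> Spec (K\<lparr>carrier := E\<rparr>)" "Q \<subset> Q'"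
  obtains a where "a \<in> D" "a \<in> Q'" "a \<notin> Q"
proof -
  interpret E: field_subring K E by fact
  obtain z where z: "z \<in> Q'" "z \<notin> Q" using Q(3) by blast
  have zE: "z \<in> E" using z(1) E.Spec_subset[OF Q(2)] by blast
  have "Q' \<inter> D \<in> Spec A" "z \<in> carrier K" "\<one> \<in> carrier K"
    using contraction_Spec[OF E Q(2)] zE by auto
  then show ?thesis
  proof (cases rule: comparable_cases)
    case (left s a)
    have "s \<in> E" "s \<notin> Q" using left E(2) Q(3) by blast+
    then have "s \<otimes> z \<notin> Q" using zE z Q(1) by (simp add: E.Spec_prime)
    moreover have "s \<otimes> z \<in> Q'" using \<open>s \<in> E\<close> z Q(2) by (simp add: E.Spec_mult)
    moreover have "s \<otimes> z = a" using left by simp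
    ultimately show ?thesis using left that by blast
  next
    case (right s a)
    have "a \<otimes> z \<in> Q'" using right E(2) z Q(2) by (intro E.Spec_mult) auto
    then show ?thesis using right by auto
  qed
qed

text \<open>This makes the results of this locale available for the complete integral closure as
  well. Denominators outside \<open>Q \<inter> D\<close> are outside \<open>Q\<close>.\<close>

lemma locally_valuation_ring_overring:
  assumes E: "field_subring K E" "D \<subseteq> E"
  shows "locally_valuation_ring K E"
proof -
  interpret E: field_subring K E by fact
  show ?thesis
  proof (intro locally_valuation_ring.intro E.field_subring_axioms locally_valuation_ring_axioms.intro)
    fix Q x y
    assume Q: "Q \<in> Spec (K\<lparr>carrier := E\<rparr>)" and xy: "x \<in> carrier K" "y \<in> carrier K"
    have "Q \<inter> D \<in> Spec A" using E Q by (rule contraction_Spec)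
    from comparable[OF this xy] E(2)
    show "\<exists>s\<in>E - Q. \<exists>a\<in>E. s \<otimes> x = a \<otimes> y \<or> s \<otimes> y = a \<otimes> x" by blast
  qed
qed

section \<open>Chains of primes in the complete integral closure\<close>

abbreviation "D' \<equiv> complete_integral_closure K D"

lemma no_prime_chain:
  assumes comp: "\<And>c. c \<in> D \<Longrightarrow> compact_space (subtopology (zariski_topology A)
      (minimal_primes A (genideal A {c})))"
    and P: "P0 \<in> Spec (K\<lparr>carrier := D'\<rparr>)" "P1 \<in> Spec (K\<lparr>carrier := D'\<rparr>)"
      "P2 \<in> Spec (K\<lparr>carrier := D'\<rparr>)" "P0 \<subset> P1" "P1 \<subset> P2"
  shows False
proof -
  have E: "field_subring K D'" "D \<subseteq> D'"
    using field_subring_complete_integral_closure subset_complete_integral_closure by auto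
  interpret E: field_subring K D' by fact
  let ?I = "\<lambda>c. genideal A {c}"
  \<comment> \<open>Lying outside \<open>P0\<close>, \<open>c\<close> is nonzero.\<close>
  obtain c where c: "c \<in> D" "c \<in> P1" "c \<notin> P0"
    using prime_contraction_strict[OF E P(1,2,4)] by blast
  obtain b where b: "b \<in> D" "b \<in> P2" "b \<notin> P1"
    using prime_contraction_strict[OF E P(2,3,5)] by blast
  have c0: "c \<noteq> \<zero>" using c E.Spec_zero[OF P(1)] by blast
  have S1: "P1 \<inter> D \<in> Spec A" and S2: "P2 \<inter> D \<in> Spec A"
    using contraction_Spec[OF E] P by auto
  have over: "P1 \<inter> D \<in> primes_over A (?I c)"
    using primes_over_genideal_subring[OF c(1), of "P1 \<inter> D"] S1 c(1,2) by blast
  \<comment> \<open>Such a \<open>P\<close> would contain \<open>P1 \<inter> D\<close>, a prime over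
    \<open>c\<close>, and hence equal it by minimality; \<open>b\<close> rules this out.\<close>
  have "\<not> P2 \<inter> D \<subseteq> P" if P': "P \<in> minimal_primes A (?I c)" for P
  proof
    assume "P2 \<inter> D \<subseteq> P"
    then have "P1 \<inter> D = P" using minimal_primesD[OF P' over] P(5) by blast
    then show False using \<open>P2 \<inter> D \<subseteq> P\<close> b by blast
  qed
  then obtain X where X: "finite X" "X \<subseteq> P2 \<inter> D"
    and avoid: "\<And>P. P \<in> minimal_primes A (?I c) \<Longrightarrow> \<not> X \<subseteq> P"
    using cring.compact_minimal_primes_avoidance[OF cring comp[OF c(1)], of "P2 \<inter> D"] by auto
  \<comment> \<open>Having \<open>c\<close> in the set meets a premise of
    \<open>mult_pow_mem\<close> and forces the local generator \<open>y\<close> to be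
    nonzero.\<close>
  let ?X = "insert c X"
  have fin: "finite ?X" "?X \<noteq> {}" "?X \<subseteq> carrier K" "?X \<subseteq> P2 \<inter> D"
    using X c P(5) by auto
  obtain y s where y: "y \<in> ?X" and s: "s \<in> D" "s \<notin> P2"
    and ys: "\<And>x. x \<in> ?X \<Longrightarrow> \<exists>a\<in>D. s \<otimes> x = a \<otimes> y"
    using finite_locally_principal[OF fin(1-3) S2] by blast
  have yc: "y \<in> D" "y \<in> P2" using y fin(4) by auto
  have "s \<noteq> \<zero>" using s E.Spec_zero[OF P(3)] by blast
  have "y \<noteq> \<zero>"
  proof
    assume "y = \<zero>"
    then have "s \<otimes> c = \<zero>" using ys[of c] by auto
    then show False using integral[of s c] s(1) c(1) c0 \<open>s \<noteq> \<zero>\<close> by auto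
  qed
  then have inv: "inv y \<in> carrier K" "y \<otimes> inv y = \<one>"
    using yc by (auto simp: field_Units)
  \<comment> \<open>Up to \<open>s\<close>, a unit of the localization at
    \<open>P2 \<inter> D\<close>, this is \<open>1 / y\<close>; the factor \<open>s\<close> clears
    the denominators of all \<open>x / y\<close> at once.\<close>
  let ?z = "s \<otimes> inv y"
  have z: "?z \<in> carrier K" using inv s by simp
  have zX: "x \<otimes> ?z \<in> D" if x: "x \<in> ?X" for x
  proof -
    obtain a where a: "a \<in> D" "s \<otimes> x = a \<otimes> y" using ys[OF x] by blast
    have "x \<otimes> ?z = (s \<otimes> x) \<otimes> inv y" using subsetD[OF fin(3) x] s inv by (simp add: m_ac)
    also have "\<dots> = a" unfolding a(2) using a yc inv by (simp add: m_assoc)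
    finally show ?thesis using a by simp
  qed
  have "c \<otimes> ?z [^] n \<in> D" for n :: nat
    using fin(1,4) avoid z zX by (intro mult_pow_mem[of ?X]) auto
  then have "almost_integral K D ?z"
    unfolding almost_integral_def using c(1) c0 by blast
  then have "?z \<in> D'"
    using z unfolding complete_integral_closure_def by blast
  then have "?z \<otimes> y \<in> P2" using E.Spec_mult[OF P(3) _ yc(2)] by blast
  moreover have "?z \<otimes> y = s" using s yc inv by (simp add: m_assoc m_comm[of "inv y"])
  ultimately show False using s by simp
qed

section \<open>Complete integral closedness without chains of three primes\<close>

text \<open>If \<open>z\<close> is almost integral but lies outside the localization at \<open>Q\<close>, then \<open>1/z\<close> lies in the
  maximal ideal of this valuation ring, and the elements of \<open>D\<close> that are divisible there by all
  powers of \<open>1/z\<close> form a nonzero prime strictly below \<open>Q\<close>.\<close>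
lemma complete_integral_closure_eq_if_no_prime_chain:
  assumes no_chain: "\<And>P0 P1 P2. \<lbrakk>P0 \<in> Spec A; P1 \<in> Spec A; P2 \<in> Spec A; P0 \<subset> P1\<rbrakk> \<Longrightarrow> \<not> P1 \<subset> P2"
  shows "complete_integral_closure K D = D"
proof
  show "complete_integral_closure K D \<subseteq> D"
  proof
    fix z assume "z \<in> complete_integral_closure K D"
    then obtain d where z: "z \<in> carrier K" and d: "d \<in> D" "d \<noteq> \<zero>"
      and dz: "\<And>n::nat. n \<ge> 1 \<Longrightarrow> d \<otimes> z [^] n \<in> D"
      by (auto simp: complete_integral_closure_def almost_integral_def)
    show "z \<in> D"
    proof (rule ccontr)
      assume "z \<notin> D"
      then obtain Q where Q: "Q \<in> Spec A" and nQ: "\<And>s. s \<in> D \<Longrightarrow> s \<notin> Q \<Longrightarrow> s \<otimes> z \<notin> D"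
        using mem_if_locally_mem[OF z] by blast
      \<comment> \<open>\<open>V\<close> is the localization at \<open>Q\<close>, with denominators
        cleared; \<open>z\<close> lies outside it.\<close>
      define V where "V = {u \<in> carrier K. \<exists>s\<in>D - Q. s \<otimes> u \<in> D}"
      have VI: "u \<in> V" if "u \<in> carrier K" "s \<in> D" "s \<notin> Q" "s \<otimes> u \<in> D" for u s
        using that by (auto simp: V_def)
      have V: "u \<in> carrier K" if "u \<in> V" for u using that by (simp add: V_def)
      have DV: "u \<in> V" if "u \<in> D" for u
        using that Spec_one[OF Q] by (intro VI[of _ \<one>]) auto
      have V_common: "\<exists>s\<in>D - Q. s \<otimes> u \<in> D \<and> s \<otimes> v \<in> D" if uv: "u \<in> V" "v \<in> V" for u v
      proof -
        obtain s t where s: "s \<in> D" "s \<notin> Q" "s \<otimes> u \<in> D" and t: "t \<in> D" "t \<notin> Q" "t \<otimes> v \<in> D"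
          using uv by (auto simp: V_def)
        have "s \<otimes> t \<otimes> u = t \<otimes> (s \<otimes> u)" "s \<otimes> t \<otimes> v = s \<otimes> (t \<otimes> v)"
          using V[OF uv(1)] V[OF uv(2)] s(1) t(1) by (simp_all add: m_ac)
        moreover have "s \<otimes> t \<in> D - Q" using s t Spec_prime[OF Q] by simp
        ultimately show ?thesis using s t by (metis closed(4))
      qed
      have Vadd: "u \<oplus> v \<in> V" if uv: "u \<in> V" "v \<in> V" for u v
      proof -
        obtain s where s: "s \<in> D" "s \<notin> Q" "s \<otimes> u \<in> D" "s \<otimes> v \<in> D" using V_common[OF uv] by blast
        then have "s \<otimes> (u \<oplus> v) \<in> D" using V[OF uv(1)] V[OF uv(2)] by (simp add: r_distr)
        then show ?thesis using V[OF uv(1)] V[OF uv(2)] s by (intro VI[of _ s]) auto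
      qed
      have Vmult: "u \<otimes> v \<in> V" if uv: "u \<in> V" "v \<in> V" for u v
      proof -
        obtain s where s: "s \<in> D" "s \<notin> Q" "s \<otimes> u \<in> D" "s \<otimes> v \<in> D" using V_common[OF uv] by blast
        have "s \<otimes> s \<otimes> (u \<otimes> v) = (s \<otimes> u) \<otimes> (s \<otimes> v)"
          using V[OF uv(1)] V[OF uv(2)] s(1) by (simp add: m_ac)
        then have "s \<otimes> s \<otimes> (u \<otimes> v) \<in> D" using s by simp
        moreover have "s \<otimes> s \<notin> Q" using s Spec_prime[OF Q] by simp
        ultimately show ?thesis using V[OF uv(1)] V[OF uv(2)] s by (intro VI[of _ "s \<otimes> s"]) auto
      qed
      define p where "p = {b \<in> D. \<forall>n::nat. b \<otimes> z [^] n \<in> V}"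
      have pD: "b \<in> D" and pV: "b \<otimes> z [^] (n::nat) \<in> V" if "b \<in> p" for b n
        using that by (auto simp: p_def)
      have pI: "b \<in> p" if "b \<in> D" "\<And>n::nat. b \<otimes> z [^] n \<in> V" for b
        using that by (simp add: p_def)
      have z1: "z \<notin> V" using nQ by (auto simp: V_def)
      have "ideal p A" unfolding ideal_iff_subring
      proof (intro conjI ballI)
        show "\<zero> \<in> p" using z DV by (intro pI) auto
        show "x \<oplus> y \<in> p" if xy: "x \<in> p" "y \<in> p" for x y
        proof -
          have "(x \<oplus> y) \<otimes> z [^] n \<in> V" for n :: nat
            using Vadd[OF pV[OF xy(1)] pV[OF xy(2)], of n n] pD[OF xy(1)] pD[OF xy(2)] z
            by (simp add: l_distr)
          then show ?thesis using pD[OF xy(1)] pD[OF xy(2)] by (intro pI) auto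
        qed
        show "a \<otimes> x \<in> p" if ax: "a \<in> D" "x \<in> p" for a x
        proof -
          have "a \<otimes> x \<otimes> z [^] n \<in> V" for n :: nat
            using Vmult[OF DV[OF ax(1)] pV[OF ax(2)], of n] pD[OF ax(2)] ax(1) z
            by (simp add: m_assoc)
          then show ?thesis using ax(1) pD[OF ax(2)] by (intro pI) auto
        qed
      qed (use pD in auto)
      moreover have "\<one> \<notin> p"
      proof
        assume "\<one> \<in> p"
        from pV[OF this, of 1] show False using z z1 by simp
      qed
      moreover have "a \<in> p \<or> b \<in> p" if ab: "a \<in> D" "b \<in> D" "a \<otimes> b \<in> p" for a b
      proof (rule ccontr)
        assume "\<not> ?thesis"
        \<comment> \<open>The two failures may occur at different exponents, so
          \<open>a \<otimes> b\<close> is tested at \<open>m + n\<close>.\<close>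
        then obtain m n :: nat where mn: "a \<otimes> z [^] m \<notin> V" "b \<otimes> z [^] n \<notin> V"
          using pI ab(1,2) by blast
        let ?x = "a \<otimes> z [^] m" and ?y = "b \<otimes> z [^] n"
        have c: "?x \<in> carrier K" "?y \<in> carrier K" "\<one> \<in> carrier K" using ab z by auto
        from Q c(1,3) show False
        proof (cases rule: comparable_cases)
          case (left s e)
          then show False using VI[OF c(1), of s] mn(1) by simp
        next
          \<comment> \<open>Now \<open>1 / ?x = e / s\<close> lies in \<open>V\<close>, and
            multiplying it by \<open>?x \<otimes> ?y\<close> would put \<open>?y\<close> into
            \<open>V\<close>.\<close>
          case (right s e)
          have xy: "?x \<otimes> ?y \<in> V"
          proof -
            have "?x \<otimes> ?y = (a \<otimes> b) \<otimes> z [^] (m + n)"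
              using ab(1,2) z by (simp add: m_ac nat_pow_mult[symmetric])
            then show ?thesis using pV[OF ab(3)] by simp
          qed
          have "s \<otimes> ?y = e \<otimes> (?x \<otimes> ?y)"
          proof -
            have "s \<otimes> ?y = (s \<otimes> \<one>) \<otimes> ?y" using right(1) c by simp
            also have "\<dots> = e \<otimes> (?x \<otimes> ?y)" unfolding right(4) using right(3) c by (simp only: m_assoc sub_carrier)
            finally show ?thesis .
          qed
          then have "s \<otimes> ?y \<in> V" using Vmult[OF DV[OF right(3)] xy] by simp
          then obtain t where t: "t \<in> D" "t \<notin> Q" "t \<otimes> (s \<otimes> ?y) \<in> D" by (auto simp: V_def)
          have "t \<otimes> s \<otimes> ?y \<in> D" using t(1,3) right(1) c by (simp only: m_assoc sub_carrier)
          moreover have "t \<otimes> s \<notin> Q" using t right(1,2) Spec_prime[OF Q] by simp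
          ultimately show False using VI[OF c(2), of "t \<otimes> s"] t(1) right(1) mn(2) by simp
        qed
      qed
      ultimately have p: "p \<in> Spec A" unfolding Spec_iff by blast
      \<comment> \<open>Almost integrality speaks of exponents from 1 on; exponent 0 gives
        \<open>d\<close> itself.\<close>
      have "d \<otimes> z [^] n \<in> V" for n :: nat
        using dz[of n] d(1) DV by (cases "n = 0") auto
      with d(1) have dp: "d \<in> p" by (rule pI)
      have zero: "{\<zero>} \<in> Spec A"
        unfolding Spec_iff ideal_iff_subring using integral by auto
      \<comment> \<open>An element \<open>b\<close> of \<open>p\<close> outside \<open>Q\<close>
        would be a unit of \<open>V\<close>, so \<open>b \<otimes> z\<close> in \<open>V\<close>
        would put \<open>z\<close> into \<open>V\<close>.\<close>
      have "p \<subseteq> Q"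
      proof
        fix b assume b: "b \<in> p"
        show "b \<in> Q"
        proof (rule ccontr)
          assume "b \<notin> Q"
          moreover obtain s where s: "s \<in> D" "s \<notin> Q" "s \<otimes> (b \<otimes> z) \<in> D"
            using pV[OF b, of 1] z by (auto simp: V_def)
          ultimately have "s \<otimes> b \<notin> Q" using pD[OF b] Spec_prime[OF Q] by simp
          then show False using nQ[of "s \<otimes> b"] s z pD[OF b] by (simp add: m_assoc)
        qed
      qed
      moreover have "p \<noteq> Q"
      proof
        assume pQ: "p = Q"
        from Q z one_closed show False
        proof (cases rule: comparable_cases)
          case (left s a)
          then show False using nQ[of s] by simp
        next
          \<comment> \<open>Here \<open>1 / z = a / s\<close>. If \<open>a\<close> were in
            \<open>Q = p\<close>, then \<open>a \<otimes> z [^] 2 = s \<otimes> z\<close> would be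
            in \<open>V\<close>, and \<open>z\<close> with it; otherwise \<open>z = s / a\<close> is
            in \<open>V\<close>.\<close>
          case (right s a)
          have "a \<notin> Q"
          proof
            assume "a \<in> Q"
            then have "a \<otimes> z [^] (2::nat) \<in> V" using pV pQ by blast
            moreover have "a \<otimes> z [^] (2::nat) = s \<otimes> z"
            proof -
              have "a \<otimes> z [^] (2::nat) = (a \<otimes> z) \<otimes> z"
                using right(3) z by (simp add: numeral_2_eq_2 m_assoc)
              also have "\<dots> = (s \<otimes> \<one>) \<otimes> z" using right(4) by simp
              finally show ?thesis using right(1) z by simp
            qed
            ultimately obtain t where t: "t \<in> D" "t \<notin> Q" "t \<otimes> (s \<otimes> z) \<in> D" by (auto simp: V_def)
            have "t \<otimes> s \<notin> Q" using t right(1,2) Spec_prime[OF Q] by simp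
            then show False using nQ[of "t \<otimes> s"] t right(1) z by (simp add: m_assoc)
          qed
          moreover have "a \<otimes> z = s" using right by simp
          ultimately show False using nQ[of a] right by simp
        qed
      qed
      ultimately have "p \<subset> Q" by blast
      moreover have "{\<zero>} \<subset> p" using dp d(2) Spec_zero[OF p] by blast
      ultimately show False using no_chain[OF zero p Q] by blast
    qed
  qed
qed (rule subset_complete_integral_closure)

end

section \<open>Krull dimension, Pruefer domains and the theorem\<close>

lemma krull_dim_le_1:
  assumes "\<And>P0 P1 P2. \<lbrakk>P0 \<in> Spec R; P1 \<in> Spec R; P2 \<in> Spec R; P0 \<subset> P1\<rbrakk> \<Longrightarrow> \<not> P1 \<subset> P2"
  shows "krull_dim R \<le> 1"
  unfolding krull_dim_def
proof (rule Sup_least, clarify)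
  fix n and P :: "nat \<Rightarrow> 'a set"
  assume P: "\<forall>i\<le>n. P i \<in> Spec R" "\<forall>i<n. P i \<subset> P (Suc i)"
  have "n \<le> 1"
  proof (rule ccontr)
    assume "\<not> n \<le> 1"
    then have "2 \<le> n" by simp
    then show False
      using P assms[of "P 0" "P 1" "P 2"] by (simp add: numeral_2_eq_2)
  qed
  then show "enat n \<le> 1" by (simp add: one_enat_def)
qed

text \<open>The valuation dichotomy for \<open>x / y\<close> and its inverse \<open>y / x\<close>
  gives the two alternatives once denominators are cleared. If \<open>x\<close> or \<open>y\<close>
  is zero, \<open>s = 1\<close> and \<open>a = 0\<close> do.\<close>

lemma prufer_domain_locally_valuation_ring:
  assumes "prufer_domain K D"
  shows "locally_valuation_ring K D"
proof -
  have "field K" "subdomain D K"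
    using assms by (auto simp: prufer_domain_def quotient_field_def)
  then interpret field_subring K D
    by (intro field_subring.intro field_subring_axioms.intro subcring.axioms(1) subdomain.axioms(1))
  show ?thesis
  proof (intro locally_valuation_ring.intro field_subring_axioms locally_valuation_ring_axioms.intro)
    fix P x y
    assume P: "P \<in> Spec A" and xy: "x \<in> carrier K" "y \<in> carrier K"
    have one: "\<one>\<^bsub>K\<^esub> \<in> D - P" using Spec_one[OF P] by simp
    show "\<exists>s\<in>D - P. \<exists>a\<in>D. s \<otimes>\<^bsub>K\<^esub> x = a \<otimes>\<^bsub>K\<^esub> y \<or> s \<otimes>\<^bsub>K\<^esub> y = a \<otimes>\<^bsub>K\<^esub> x"
    proof (cases "x = \<zero>\<^bsub>K\<^esub> \<or> y = \<zero>\<^bsub>K\<^esub>")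
      case True
      then show ?thesis using xy by (intro bexI[OF _ one] bexI[of _ "\<zero>\<^bsub>K\<^esub>"]) auto
    next
      case False
      have fraction: "\<exists>s\<in>D - P. \<exists>a\<in>D. s \<otimes>\<^bsub>K\<^esub> u = a \<otimes>\<^bsub>K\<^esub> v"
        if uv: "u \<in> carrier K" "v \<in> carrier K - {\<zero>\<^bsub>K\<^esub>}"
          and loc: "u \<otimes>\<^bsub>K\<^esub> inv\<^bsub>K\<^esub> v \<in> localization K D P" for u v
      proof -
        obtain a s where as: "a \<in> D" "s \<in> D" "s \<notin> P" "u \<otimes>\<^bsub>K\<^esub> inv\<^bsub>K\<^esub> v = a \<otimes>\<^bsub>K\<^esub> inv\<^bsub>K\<^esub> s"
          using loc by (auto simp: localization_def)
        have "s \<noteq> \<zero>\<^bsub>K\<^esub>" using as Spec_zero[OF P] by blast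
        then have i: "inv\<^bsub>K\<^esub> s \<in> carrier K" "inv\<^bsub>K\<^esub> s \<otimes>\<^bsub>K\<^esub> s = \<one>\<^bsub>K\<^esub>"
          "inv\<^bsub>K\<^esub> v \<in> carrier K" "inv\<^bsub>K\<^esub> v \<otimes>\<^bsub>K\<^esub> v = \<one>\<^bsub>K\<^esub>"
          using as uv by (auto simp: field_Units)
        have "s \<otimes>\<^bsub>K\<^esub> u = s \<otimes>\<^bsub>K\<^esub> (u \<otimes>\<^bsub>K\<^esub> inv\<^bsub>K\<^esub> v \<otimes>\<^bsub>K\<^esub> v)"
          using i uv by (simp add: m_assoc)
        also have "\<dots> = a \<otimes>\<^bsub>K\<^esub> (inv\<^bsub>K\<^esub> s \<otimes>\<^bsub>K\<^esub> s) \<otimes>\<^bsub>K\<^esub> v"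
          unfolding as(4) using i(1) uv as(1,2) by (simp add: m_ac)
        finally show ?thesis using as i(2) by auto
      qed
      let ?z = "x \<otimes>\<^bsub>K\<^esub> inv\<^bsub>K\<^esub> y"
      have U: "x \<in> Units K" "y \<in> Units K" using False xy by (auto simp: field_Units)
      then have "?z \<in> Units K" by simp
      then have "?z \<in> carrier K - {\<zero>\<^bsub>K\<^esub>}" by (simp add: field_Units)
      moreover have "inv\<^bsub>K\<^esub> ?z = y \<otimes>\<^bsub>K\<^esub> inv\<^bsub>K\<^esub> x"
      proof (rule comm_inv_char)
        have "?z \<otimes>\<^bsub>K\<^esub> (y \<otimes>\<^bsub>K\<^esub> inv\<^bsub>K\<^esub> x)
            = (x \<otimes>\<^bsub>K\<^esub> inv\<^bsub>K\<^esub> x) \<otimes>\<^bsub>K\<^esub> (y \<otimes>\<^bsub>K\<^esub> inv\<^bsub>K\<^esub> y)"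
          using xy Units_inv_closed[OF U(1)] Units_inv_closed[OF U(2)] by (simp only: m_ac m_closed)
        then show "?z \<otimes>\<^bsub>K\<^esub> (y \<otimes>\<^bsub>K\<^esub> inv\<^bsub>K\<^esub> x) = \<one>\<^bsub>K\<^esub>" using U by simp
      qed (use U xy in auto)
      moreover have "valuation_domain K (localization K D P)"
        using assms P by (simp add: prufer_domain_def)
      ultimately have "?z \<in> localization K D P \<or> y \<otimes>\<^bsub>K\<^esub> inv\<^bsub>K\<^esub> x \<in> localization K D P"
        unfolding valuation_domain_def by metis
      then show ?thesis using fraction[of x y] fraction[of y x] False xy by blast
    qed
  qed
qed

theorem proposition2p14:
  fixes K :: "('a, 'b) ring_scheme" and D :: "'a set"
  assumes "prufer_domain K D"
    and "\<And>I. finitely_generated_ideal (K\<lparr>carrier := D\<rparr>) I \<Longrightarrow>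
           compact_space (subtopology (zariski_topology (K\<lparr>carrier := D\<rparr>))
             (minimal_primes (K\<lparr>carrier := D\<rparr>) I))"
  shows "krull_dim (K\<lparr>carrier := complete_integral_closure K D\<rparr>) \<le> 1
    \<and> completely_integrally_closed K (complete_integral_closure K D)"
proof -
  let ?E = "complete_integral_closure K D"
  interpret D: locally_valuation_ring K D
    using assms(1) by (rule prufer_domain_locally_valuation_ring)
  have DE: "D \<subseteq> ?E" by (rule D.subset_complete_integral_closure)
  \<comment> \<open>The chain argument runs over \<open>D\<close>, whereas the criterion for being
    its own complete integral closure is applied to \<open>?E\<close>.\<close>
  interpret E: locally_valuation_ring K ?E
    using D.field_subring_complete_integral_closure DE by (rule D.locally_valuation_ring_overring)
  have fg: "finitely_generated_ideal D.A (genideal D.A {c})" if "c \<in> D" for c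
    unfolding finitely_generated_ideal_def using that by (intro exI[of _ "{c}"]) simp
  have no_chain: "\<not> P1 \<subset> P2"
    if "P0 \<in> Spec E.A" "P1 \<in> Spec E.A" "P2 \<in> Spec E.A" "P0 \<subset> P1" for P0 P1 P2
    using D.no_prime_chain[OF assms(2)[OF fg] that(1-4)] by blast
  have "completely_integrally_closed K ?E"
    unfolding completely_integrally_closed_def quotient_field_def
  proof (intro conjI)
    show "field K" by (rule D.field_axioms)
    show "subdomain ?E K" by (rule D.subdomainI'[OF E.subring])
    show "carrier K = {a \<otimes>\<^bsub>K\<^esub> inv\<^bsub>K\<^esub> b | a b. a \<in> ?E \<and> b \<in> ?E - {\<zero>\<^bsub>K\<^esub>}}" (is "_ = ?F")
    proof
      have "carrier K = {a \<otimes>\<^bsub>K\<^esub> inv\<^bsub>K\<^esub> b | a b. a \<in> D \<and> b \<in> D - {\<zero>\<^bsub>K\<^esub>}}"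
        using assms(1) by (simp add: prufer_domain_def quotient_field_def)
      then show "carrier K \<subseteq> ?F" using DE by blast
      show "?F \<subseteq> carrier K" by (auto simp: D.field_Units)
    qed
    show "complete_integral_closure K ?E = ?E"
      using no_chain by (rule E.complete_integral_closure_eq_if_no_prime_chain)
  qed
  moreover have "krull_dim E.A \<le> 1"
    using no_chain by (rule krull_dim_le_1)
  ultimately show ?thesis by blast
qed

end
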